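(* Let $f:\mathbb{R}^{n_1}\to\mathbb{R}$ and $g:\mathbb{R}^{n_2}\to\mathbb{R}$ be closed convex functions, $\mathcal{X}\subseteq\mathbb{R}^{n_1}$ and $\mathcal{Y}\subseteq\mathbb{R}^{n_2}$ closed convex sets, $A\in\mathbb{R}^{m\times n_1}$, $B\in\mathbb{R}^{m\times n_2}$, $b\in\mathbb{R}^m$, and assume that the set of KKT points of $$\min_{x,y}\{f(x)+g(y):\ Ax+By=b,\ x\in\mathcal{X},\ y\in\mathcal{Y}\}\qquad(\mathrm{P})$$ is nonempty. Let $\Omega,\theta,F,\Omega^*,\mathcal{L},G$ be as defined in the context. Let $\beta>0$ and assume that $0<\tau<1/\rho(A^TA)$ and $0<\eta<1/\rho(B^TB)$. Let $\{w^k=(x^k,y^k,p^k)\}_{k=0}^\infty$ be generated by the linearized ADMM (defined in the context) from any starting point $w^0=(x^0,y^0,p^0)$. Then: 1. The sequence $\{w^k\}_{k=0}^\infty$ converges to an element of $\Omega^*$, i.e. there exists $w^\star=(x^\star,y^\star,p^\star)\in\Omega^*$ such that $\lim_{k\to\infty}w^k=w^\star$. Moreover, $(x^\star,y^\star)$ is a solution of $(\mathrm{P})$. 2. For any fixed integer $k>0$, define $\bar w^k:=\frac{1}{k+1}\sum_{i=0}^kw^{i+1}$. Then $$\bar w^k\in\Omega,\qquad\theta(w)-\theta(\bar w^k)+(w-\bar w^k)^TF(w)\ge-\frac{\|w-w^0\|_G^2}{2(k+1)}\quad\text{for all } w\in\Omega,$$ or, equivalently, $\bar w^k=(\bar x^k,\bar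 y^k,\bar p^k)\in\Omega$ and $$\mathcal{L}(\bar x^k,\bar y^k,p)-\mathcal{L}(x,y,\bar p^k)\le\frac{\|w-w^0\|_G^2}{2(k+1)}\quad\text{for all } w=(x,y,p)\in\Omega .$$ 3. For every integer $k>0$ and every $w^*\in\Omega^*$, $$\|w^k-w^{k-1}\|_G^2\le\frac{\|w^0-w^*\|_G^2}{k}.$$ Moreover, as $k\to\infty$, $\|w^k-w^{k-1}\|_G^2=o(1/k)$.
   Context: $\rho(M)$ denotes the spectral radius of a square matrix $M$; $\langle\cdot,\cdot\rangle$ and $\|\cdot\|$ are the standard inner product and $\ell_2$ norm; for a symmetric positive semidefinite matrix $G$, $\|u\|_G:=\sqrt{u^TGu}$. Put $\Omega:=\mathcal{X}\times\mathcal{Y}\times\mathbb{R}^m$ and, for $w=(x,y,p)$, $$\theta(w):=f(x)+g(y),\qquad F(w):=\begin{pmatrix} -A^Tp \\ -B^Tp \\ {A}x+By-b \end{pmatrix}.$$ $\Omega^*$ is the set of solutions of the mixed variational inequality problem: $w^*\in\Omega$ with $\theta(w)-\theta(w^* )+\langle w-w^*,F(w^* )\rangle\ge0$ for all $w\in\Omega$ (these are the KKT points of $(\mathrm{P})$). The Lagrangian is $\mathcal{L}(x,y,p):=f(x)+g(y)-\langle p,Ax+By-b\rangle$. The matrix $G$ is $$G=\begin{pmatrix}\beta\left(\frac1\tau I-A^TA\right)&0&0\\0&\frac\beta\eta I&-B^T\\0&-B&\frac1\beta I\end{pmatrix},$$ where $I$ denotes the identity matrix of appropriate size. Linearized ADMM: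 given $(x^k,y^k,p^k)$, iterate for $k=0,1,2,\dots$ $$u^k=A^T(Ax^k+By^k-b),$$ $$x^{k+1}=\arg\min_{x\in\mathcal{X}}\ f(x)-\langle p^k,Ax\rangle+\frac{\beta}{2\tau}\|x-(x^k-\tau u^k)\|^2,$$ $$p^{k+1}=p^k-\beta(Ax^{k+1}+By^k-b),$$ $$v^k=B^T(Ax^{k+1}+By^k-b),$$ $$y^{k+1}=\arg\min_{y\in\mathcal{Y}}\ g(y)-\langle p^{k+1},By\rangle+\frac{\beta}{2\eta}\|y-(y^k-\eta v^k)\|^2 .$$ *)

theory Defs
  imports "HOL-Analysis.Analysis" "HOL-Library.Landau_Symbols"
begin

text \<open>
  The spectral radius: the largest modulus of a complex eigenvalue of a real square matrix.
  The set is finite and nonempty, so the supremum is a maximum.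
\<close>

definition spectral_radius :: "real^'n^'n \<Rightarrow> real" where
  "spectral_radius M =
     Sup {cmod c | c. \<exists>v :: complex^'n. v \<noteq> 0 \<and> map_matrix complex_of_real M *v v = c *s v}"

text \<open>
  A column vector with blocks \<open>x\<close>, \<open>y\<close>, \<open>p\<close> is a triple; the inner product and the norm of the
  product type are the standard ones of the concatenated vector.
\<close>

definition Omega :: "(real^'n1) set \<Rightarrow> (real^'n2) set \<Rightarrow> ((real^'n1) \<times> (real^'n2) \<times> (real^'m)) set" where
  "Omega X Y = X \<times> Y \<times> UNIV"

definition theta :: "(real^'n1 \<Rightarrow> real) \<Rightarrow> (real^'n2 \<Rightarrow> real)
    \<Rightarrow> (real^'n1) \<times> (real^'n2) \<times> (real^'m) \<Rightarrow> real" where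
  "theta f g = (\<lambda>(x, y, p). f x + g y)"

definition vi_map :: "real^'n1^'m \<Rightarrow> real^'n2^'m \<Rightarrow> real^'m
    \<Rightarrow> (real^'n1) \<times> (real^'n2) \<times> (real^'m) \<Rightarrow> (real^'n1) \<times> (real^'n2) \<times> (real^'m)" where
  "vi_map A B b = (\<lambda>(x, y, p). (- (transpose A *v p), - (transpose B *v p), A *v x + B *v y - b))"

definition Omega_star :: "(real^'n1 \<Rightarrow> real) \<Rightarrow> (real^'n2 \<Rightarrow> real)
    \<Rightarrow> (real^'n1) set \<Rightarrow> (real^'n2) set \<Rightarrow> real^'n1^'m \<Rightarrow> real^'n2^'m \<Rightarrow> real^'m
    \<Rightarrow> ((real^'n1) \<times> (real^'n2) \<times> (real^'m)) set" where
  "Omega_star f g X Y A B b =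
     {ws \<in> Omega X Y. \<forall>w \<in> Omega X Y.
        theta f g w - theta f g ws + (w - ws) \<bullet> vi_map A B b ws \<ge> 0}"

definition lagrangian :: "(real^'n1 \<Rightarrow> real) \<Rightarrow> (real^'n2 \<Rightarrow> real)
    \<Rightarrow> real^'n1^'m \<Rightarrow> real^'n2^'m \<Rightarrow> real^'m
    \<Rightarrow> real^'n1 \<Rightarrow> real^'n2 \<Rightarrow> real^'m \<Rightarrow> real" where
  "lagrangian f g A B b x y p = f x + g y - p \<bullet> (A *v x + B *v y - b)"

definition is_solution :: "(real^'n1 \<Rightarrow> real) \<Rightarrow> (real^'n2 \<Rightarrow> real)
    \<Rightarrow> (real^'n1) set \<Rightarrow> (real^'n2) set \<Rightarrow> real^'n1^'m \<Rightarrow> real^'n2^'m \<Rightarrow> real^'m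
    \<Rightarrow> (real^'n1) \<times> (real^'n2) \<Rightarrow> bool" where
  "is_solution f g X Y A B b =
     is_arg_min (\<lambda>(x, y). f x + g y) (\<lambda>(x, y). x \<in> X \<and> y \<in> Y \<and> A *v x + B *v y = b)"

text \<open>The block matrix \<open>G\<close>, given by its action on a block column vector.\<close>

definition G_mat :: "real^'n1^'m \<Rightarrow> real^'n2^'m \<Rightarrow> real \<Rightarrow> real \<Rightarrow> real
    \<Rightarrow> (real^'n1) \<times> (real^'n2) \<times> (real^'m) \<Rightarrow> (real^'n1) \<times> (real^'n2) \<times> (real^'m)" where
  "G_mat A B \<beta> \<tau> \<eta> = (\<lambda>(x, y, p).
     ((\<beta> *\<^sub>R ((1 / \<tau>) *\<^sub>R mat 1 - transpose A ** A)) *v x,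
      (\<beta> / \<eta>) *\<^sub>R y - transpose B *v p,
      - (B *v y) + (1 / \<beta>) *\<^sub>R p))"

definition seminorm_of :: "('a::real_inner \<Rightarrow> 'a) \<Rightarrow> 'a \<Rightarrow> real" where
  "seminorm_of G u = sqrt (u \<bullet> G u)"

text \<open>
  Both subproblems are strongly convex, so being a minimiser determines the next iterate.
  The starting point \<open>(x 0, y 0, p 0)\<close> is unrestricted; in particular it need not lie in
  \<open>Omega X Y\<close>.
\<close>

definition linearized_admm :: "(real^'n1 \<Rightarrow> real) \<Rightarrow> (real^'n2 \<Rightarrow> real)
    \<Rightarrow> (real^'n1) set \<Rightarrow> (real^'n2) set \<Rightarrow> real^'n1^'m \<Rightarrow> real^'n2^'m \<Rightarrow> real^'m
    \<Rightarrow> real \<Rightarrow> real \<Rightarrow> real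
    \<Rightarrow> (nat \<Rightarrow> real^'n1) \<Rightarrow> (nat \<Rightarrow> real^'n2) \<Rightarrow> (nat \<Rightarrow> real^'m) \<Rightarrow> bool" where
  "linearized_admm f g X Y A B b \<beta> \<tau> \<eta> x y p \<longleftrightarrow>
     (\<forall>k.
        let u = transpose A *v (A *v x k + B *v y k - b);
            v = transpose B *v (A *v x (Suc k) + B *v y k - b)
        in is_arg_min
             (\<lambda>z. f z - p k \<bullet> (A *v z) + \<beta> / (2 * \<tau>) * (norm (z - (x k - \<tau> *\<^sub>R u)))\<^sup>2)
             (\<lambda>z. z \<in> X) (x (Suc k))
         \<and> p (Suc k) = p k - \<beta> *\<^sub>R (A *v x (Suc k) + B *v y k - b)
         \<and> is_arg_min
             (\<lambda>z. g z - p (Suc k) \<bullet> (B *v z) + \<beta> / (2 * \<eta>) * (norm (z - (y k - \<eta> *\<^sub>R v)))\<^sup>2)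
             (\<lambda>z. z \<in> Y) (y (Suc k)))"

end

theory Submission
  imports Defs
begin

text \<open>
  With the multiplier updated between the two primal steps, the optimality conditions of one
  iteration combine to
  \<open>\<theta> v - \<theta> w\<^sup>+ + \<langle>v - w\<^sup>+, F w\<^sup>+ + G (w\<^sup>+ - w)\<rangle> \<ge> 0\<close> for all \<open>v \<in> \<Omega>\<close>: linearized ADMM is
  exactly the proximal point method in the metric \<open>G\<close> for the mixed variational inequality.
  The step size conditions make \<open>G\<close> positive definite.
  The three-point identity then gives the Fejer inequality
  \<open>\<parallel>w\<^sup>+ - w\<^sup>*\<parallel>\<^sub>G\<^sup>2 + \<parallel>w\<^sup>+ - w\<parallel>\<^sub>G\<^sup>2 \<le> \<parallel>w - w\<^sup>*\<parallel>\<^sub>G\<^sup>2\<close>, so the iterates are bounded, the squared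
  steps are summable and every cluster point is a solution, hence the limit. Averaging the
  inequality for a general \<open>v\<close> gives the ergodic rate, and the \<open>o(1/k)\<close> rate holds because the
  squared steps are also nonincreasing.
\<close>

subsection \<open>The spectral radius of a Gram matrix\<close>

text \<open>A continuous function attains its maximum on the compact unit sphere, and homogeneity of
  degree two extends the bound to every \<open>z\<close>. This serves the Gram matrix and, applied
  to \<open>- G\<close>, the coercivity of the metric.\<close>

lemma exists_rayleigh_maximizer:
  fixes T :: "'a::euclidean_space \<Rightarrow> 'a"
  assumes "linear T"
  obtains v where "norm v = 1" "\<And>z. z \<bullet> T z \<le> (v \<bullet> T v) * (norm z)\<^sup>2"
proof -
  have "continuous_on (sphere 0 1) (\<lambda>z. z \<bullet> T z)"
    by (intro continuous_intros linear_continuous_on) (use assms in \<open>simp add: linear_conv_bounded_linear\<close>)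
  moreover obtain e :: 'a where "e \<in> Basis" using nonempty_Basis by blast
  then have "sphere (0::'a) 1 \<noteq> {}" by (metis norm_Basis mem_sphere_0 empty_iff)
  ultimately have "\<exists>v\<in>sphere 0 1. \<forall>z\<in>sphere 0 1. z \<bullet> T z \<le> v \<bullet> T v"
    by (intro continuous_attains_sup compact_sphere)
  then obtain v where v: "v \<in> sphere 0 1"
      and max: "\<And>z. z \<in> sphere 0 1 \<Longrightarrow> z \<bullet> T z \<le> v \<bullet> T v"
    by blast
  have "z \<bullet> T z \<le> (v \<bullet> T v) * (norm z)\<^sup>2" for z
  proof (cases "z = 0")
    case False
    have "(z /\<^sub>R norm z) \<bullet> T (z /\<^sub>R norm z) \<le> v \<bullet> T v"
      by (rule max) (use False in simp)
    also have "(z /\<^sub>R norm z) \<bullet> T (z /\<^sub>R norm z) = (z \<bullet> T z) / (norm z)\<^sup>2"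
      by (simp add: linear_cmul[OF assms] power2_eq_square divide_inverse)
    finally show ?thesis using False by (simp add: pos_divide_le_eq)
  qed simp
  with v that show ?thesis by simp
qed

text \<open>
  The form of \<open>S = l I - T\<close> is nonnegative and vanishes at \<open>v\<close>, so \<open>t \<mapsto> \<langle>v + t S v, S (v + t S v)\<rangle>\<close>
  has no linear term; the \<open>t\<close> below makes it negative unless \<open>S v = 0\<close>.
\<close>

lemma rayleigh_maximizer_eigenvector:
  fixes T :: "'a::real_inner \<Rightarrow> 'a"
  assumes lin: "linear T" and sym: "\<And>u v. u \<bullet> T v = T u \<bullet> v"
    and "norm v = 1" and max: "\<And>z. z \<bullet> T z \<le> (v \<bullet> T v) * (norm z)\<^sup>2"
  shows "T v = (v \<bullet> T v) *\<^sub>R v"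
proof -
  define l where "l = v \<bullet> T v"
  define S where "S z = l *\<^sub>R z - T z" for z
  define a c where "a = (norm (S v))\<^sup>2" and "c = S v \<bullet> S (S v)"
  have S_nonneg: "z \<bullet> S z \<ge> 0" for z
    using max[of z] by (simp add: S_def l_def inner_diff_right power2_norm_eq_inner)
  have "v \<bullet> v = 1" using \<open>norm v = 1\<close> by (simp add: dot_square_norm)
  then have Sv: "v \<bullet> S v = 0"
    by (simp add: S_def l_def inner_diff_right)
  have S_sym: "x \<bullet> S z = z \<bullet> S x" for x z
    using sym[of x z] by (simp add: S_def inner_diff_right inner_commute)
  have S_lin: "linear S"
    unfolding S_def by (intro linear_compose_sub lin linear_scale_self)
  define t where "t = - a / (c + 1)"
  have c: "c \<ge> 0" unfolding c_def by (rule S_nonneg)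
  have "0 \<le> (v + t *\<^sub>R S v) \<bullet> S (v + t *\<^sub>R S v)" by (rule S_nonneg)
  also have "\<dots> = 2 * t * a + t\<^sup>2 * c"
    using Sv S_sym[of v "S v"] unfolding a_def c_def power2_norm_eq_inner
    by (simp add: linear_add[OF S_lin] linear_cmul[OF S_lin] inner_add_left inner_add_right
        power2_eq_square algebra_simps)
  also have "\<dots> = - (a\<^sup>2 * (c + 2) / (c + 1)\<^sup>2)"
    using c unfolding t_def by (simp add: divide_simps power2_eq_square) (simp add: algebra_simps)
  finally have "a\<^sup>2 * (c + 2) / (c + 1)\<^sup>2 \<le> 0" by simp
  then have "a = 0"
    using c by (auto simp: divide_le_0_iff mult_le_0_iff)
  then show ?thesis by (simp add: a_def S_def l_def)
qed

lemma norm_vector_scalar_mult: "norm (c *s v) = norm c * norm v"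
  for v :: "'a::real_normed_field ^ 'n"
  by (simp add: norm_vec_def norm_mult L2_set_right_distrib)

lemma inner_vector_matrix: "z \<bullet> (p v* A) = (A *v z) \<bullet> p"
  for A :: "real^'n^'m"
  by (metis dot_lmul_matrix inner_commute)

text \<open>The maximum \<open>l\<close> of the Rayleigh quotient of the Gram matrix is a
  nonnegative real eigenvalue. Complexifying its eigenvector puts \<open>l\<close> into the set
  whose supremum is the spectral radius, so \<open>l\<close> is at most that radius.\<close>

lemma norm_matrix_vector_le_spectral_radius:
  fixes A :: "real^'n^'m"
  shows "(norm (A *v z))\<^sup>2 \<le> spectral_radius (transpose A ** A) * (norm z)\<^sup>2"
    and "spectral_radius (transpose A ** A) \<ge> 0"
proof -
  define M where "M = transpose A ** A"
  define E where "E = {cmod c | c. \<exists>v :: complex^'n. v \<noteq> 0 \<and> map_matrix complex_of_real M *v v = c *s v}"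
  have quad: "u \<bullet> (M *v v) = (A *v u) \<bullet> (A *v v)" for u v
    unfolding M_def
    by (simp only: matrix_vector_mul_assoc[symmetric] transpose_matrix_vector inner_vector_matrix)
  have "linear ((*v) M)" by simp
  then obtain v where v: "norm v = 1" and max: "\<And>z. z \<bullet> (M *v z) \<le> (v \<bullet> (M *v v)) * (norm z)\<^sup>2"
    by (rule exists_rayleigh_maximizer) (rule that)
  define l where "l = v \<bullet> (M *v v)"
  have eig: "M *v v = l *\<^sub>R v"
    unfolding l_def
  proof (rule rayleigh_maximizer_eigenvector[OF _ _ v max])
    show "u \<bullet> (M *v v) = (M *v u) \<bullet> v" for u v
      unfolding inner_commute[of "M *v u"] quad by (rule inner_commute)
  qed simp
  have l: "l \<ge> 0" by (simp add: l_def quad)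
  define u :: "complex^'n" where "u = (\<chi> i. complex_of_real (v $ i))"
  have "v \<noteq> 0" using v by auto
  then have "u \<noteq> 0" by (simp add: u_def vec_eq_iff)
  moreover have "map_matrix complex_of_real M *v u = complex_of_real l *s u"
  proof -
    have "(\<Sum>j\<in>UNIV. M $ i $ j * v $ j) = l * v $ i" for i
      using arg_cong[OF eig, of "\<lambda>x. x $ i"] by (simp add: matrix_vector_mult_def)
    then show ?thesis
      by (simp only: vec_eq_iff matrix_vector_mult_def u_def vec_lambda_beta nth_map_matrix
          vector_smult_component of_real_mult[symmetric] of_real_sum[symmetric]) simp
  qed
  ultimately have "cmod (complex_of_real l) \<in> E"
    unfolding E_def by (intro CollectI exI[of _ "complex_of_real l"] exI[of _ u] conjI refl)
  then have "l \<in> E" using l by simp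
  \<comment> \<open>\<open>cSup_upper\<close> requires boundedness; the operator norm of the
    complexified matrix bounds the modulus of every eigenvalue.\<close>
  moreover have "bdd_above E"
  proof (rule bdd_aboveI)
    fix r assume "r \<in> E"
    then obtain c and z :: "complex^'n" where r: "r = cmod c" "z \<noteq> 0"
      "map_matrix complex_of_real M *v z = c *s z" unfolding E_def by blast
    have "cmod c * norm z \<le> onorm ((*v) (map_matrix complex_of_real M)) * norm z"
      using onorm[OF matrix_vector_mul_bounded_linear, of "map_matrix complex_of_real M" z]
      unfolding r(3) norm_vector_scalar_mult .
    then show "r \<le> onorm ((*v) (map_matrix complex_of_real M))" using r(1,2) by simp
  qed
  ultimately have le: "l \<le> spectral_radius M"
    unfolding spectral_radius_def E_def[symmetric] by (rule cSup_upper)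
  then show "spectral_radius (transpose A ** A) \<ge> 0" using l unfolding M_def by linarith
  have "(norm (A *v z))\<^sup>2 \<le> l * (norm z)\<^sup>2"
    using max[of z] by (simp add: quad l_def power2_norm_eq_inner)
  also have "\<dots> \<le> spectral_radius M * (norm z)\<^sup>2" by (intro mult_right_mono le) simp
  finally show "(norm (A *v z))\<^sup>2 \<le> spectral_radius (transpose A ** A) * (norm z)\<^sup>2"
    by (simp add: M_def)
qed

text \<open>The extended-real bound gives \<open>?r * \<tau> < 1\<close>. A zero radius is treated
  apart: the quotient is then infinite and the product is zero.\<close>

lemma norm_matrix_vector_less_step_size:
  fixes A :: "real^'n^'m"
  assumes "0 < \<tau>" "ereal \<tau> < 1 / ereal (spectral_radius (transpose A ** A))" "z \<noteq> 0"
  shows "(norm (A *v z))\<^sup>2 < (norm z)\<^sup>2 / \<tau>"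
proof -
  let ?r = "spectral_radius (transpose A ** A)"
  have "?r * \<tau> < 1"
  proof (cases "?r = 0")
    case False
    then have "?r > 0" using norm_matrix_vector_le_spectral_radius(2)[of A] by simp
    then show ?thesis using assms by (simp add: one_ereal_def pos_less_divide_eq mult.commute)
  qed simp
  then have "?r < 1 / \<tau>" using assms by (simp add: pos_less_divide_eq)
  then have "?r * (norm z)\<^sup>2 < 1 / \<tau> * (norm z)\<^sup>2" using assms by (intro mult_strict_right_mono) auto
  then show ?thesis using norm_matrix_vector_le_spectral_radius(1)[of A z] by simp
qed

subsection \<open>The proximal point method in a quadratic metric\<close>

text \<open>By monotonicity, each of the at least \<open>n / 2\<close> indices in
  \<open>{n div 2..<n}\<close> contributes at least \<open>a n\<close>. So \<open>n * a n\<close> is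
  at most twice a difference of two partial sums with the same limit.\<close>

lemma decseq_summable_imp_mult_tendsto_0:
  fixes a :: "nat \<Rightarrow> real"
  assumes "decseq a" "summable a" "\<And>n. a n \<ge> 0"
  shows "(\<lambda>n. real n * a n) \<longlonglongrightarrow> 0"
proof (rule tendsto_sandwich[of "\<lambda>_. 0"])
  show "\<forall>\<^sub>F n in sequentially. real n * a n \<le> 2 * ((\<Sum>i<n. a i) - (\<Sum>i<n div 2. a i))"
  proof (rule always_eventually, rule allI)
    fix n
    have "real n \<le> 2 * real (n - n div 2)" by linarith
    then have "real n * a n \<le> 2 * (real (n - n div 2) * a n)"
      using mult_right_mono[OF _ assms(3), of "real n" "2 * real (n - n div 2)" n]
      by (simp only: mult.assoc)
    also have "real (n - n div 2) * a n \<le> (\<Sum>i=n div 2..<n. a i)"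
      using sum_bounded_below[of "{n div 2..<n}" "a n" a] decseqD[OF assms(1)] by simp
    also have "\<dots> = (\<Sum>i<n. a i) - (\<Sum>i<n div 2. a i)"
      using sum_diff_nat_ivl[of 0 "n div 2" n a] by (simp add: atLeast0LessThan)
    finally show "real n * a n \<le> 2 * ((\<Sum>i<n. a i) - (\<Sum>i<n div 2. a i))" by simp
  qed
  have half: "filterlim (\<lambda>n::nat. n div 2) sequentially sequentially"
    unfolding filterlim_at_top
  proof
    fix Z :: nat show "\<forall>\<^sub>F n in sequentially. Z \<le> n div 2"
      using eventually_ge_at_top[of "2 * Z"] by eventually_elim simp
  qed
  have S: "(\<lambda>n. \<Sum>i<n. a i) \<longlonglongrightarrow> suminf a" by (rule summable_LIMSEQ[OF assms(2)])
  show "(\<lambda>n. 2 * ((\<Sum>i<n. a i) - (\<Sum>i<n div 2. a i))) \<longlonglongrightarrow> 0"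
    using tendsto_mult_left[OF tendsto_diff[OF S filterlim_compose[OF S half]], of 2] by simp
  show "\<forall>\<^sub>F n in sequentially. 0 \<le> real n * a n" using assms(3) by simp
qed simp

text \<open>First-order optimality without subgradients: compare \<open>zs\<close> with
  \<open>zs + t (z - zs)\<close>, bound \<open>h\<close> there by convexity, divide by
  \<open>t\<close> and let \<open>t\<close> tend to 0 from the right. Only the quadratic remainder
  still carries a factor \<open>t\<close>, and it vanishes.\<close>

lemma proximal_optimality:
  fixes h :: "'a::real_inner \<Rightarrow> real"
  assumes h: "convex_on UNIV h" and S: "convex S" and "linear L"
    and zs: "is_arg_min (\<lambda>z. h z - q \<bullet> L z + \<gamma> / 2 * (norm (z - a))\<^sup>2) (\<lambda>z. z \<in> S) zs"
    and z: "z \<in> S"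
  shows "h z - h zs - q \<bullet> L (z - zs) + \<gamma> * ((z - zs) \<bullet> (zs - a)) \<ge> 0"
proof -
  define D where "D = h z - h zs - q \<bullet> L (z - zs) + \<gamma> * ((z - zs) \<bullet> (zs - a))"
  have zsS: "zs \<in> S" using zs by (simp add: is_arg_min_def)
  have "D + t * (\<gamma> / 2 * (norm (z - zs))\<^sup>2) \<ge> 0" if t: "t > 0" "t < 1" for t
  proof -
    define zt where "zt = (1 - t) *\<^sub>R zs + t *\<^sub>R z"
    have zt: "zt = zs + t *\<^sub>R (z - zs)" by (simp add: zt_def algebra_simps)
    have "zt \<in> S" unfolding zt_def using S zsS z t by (simp add: convex_alt)
    then have "h zs - q \<bullet> L zs + \<gamma> / 2 * (norm (zs - a))\<^sup>2 \<le> h zt - q \<bullet> L zt + \<gamma> / 2 * (norm (zt - a))\<^sup>2"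
      using zs by (auto simp: is_arg_min_linorder)
    moreover have "h zt \<le> (1 - t) * h zs + t * h z"
      unfolding zt_def using t by (intro convex_onD[OF h]) auto
    moreover have "q \<bullet> L zt = q \<bullet> L zs + t * (q \<bullet> L (z - zs))"
      unfolding zt by (simp add: linear_add[OF \<open>linear L\<close>] linear_cmul[OF \<open>linear L\<close>] inner_add_right)
    moreover have "\<gamma> / 2 * (norm (zt - a))\<^sup>2 = \<gamma> / 2 * (norm (zs - a))\<^sup>2 + t * (\<gamma> * ((z - zs) \<bullet> (zs - a)))
        + t * (t * (\<gamma> / 2 * (norm (z - zs))\<^sup>2))"
    proof -
      have "zt - a = (zs - a) + t *\<^sub>R (z - zs)" by (simp add: zt)
      then have "(norm (zt - a))\<^sup>2 = (norm (zs - a))\<^sup>2 + 2 * t * ((z - zs) \<bullet> (zs - a)) + t * t * (norm (z - zs))\<^sup>2"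
        by (simp only: power2_norm_eq_inner inner_add_left inner_add_right inner_scaleR_left
            inner_scaleR_right inner_commute[of "zs - a" "z - zs"])
             (simp add: algebra_simps)
      moreover have "\<gamma> / 2 * (n + 2 * t * i + t * t * m) = \<gamma> / 2 * n + t * (\<gamma> * i) + t * (t * (\<gamma> / 2 * m))"
        for n i m by (simp add: algebra_simps)
      ultimately show ?thesis by (simp only:)
    qed
    ultimately have "0 \<le> t * (D + t * (\<gamma> / 2 * (norm (z - zs))\<^sup>2))"
      unfolding D_def by (simp add: algebra_simps)
    then show ?thesis using t by (simp add: zero_le_mult_iff)
  qed
  then have "\<forall>\<^sub>F t in at_right 0. D + t * (\<gamma> / 2 * (norm (z - zs))\<^sup>2) \<ge> 0"
    by (auto simp: eventually_at_right_field intro!: exI[of _ 1])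
  moreover have "((\<lambda>t. D + t * (\<gamma> / 2 * (norm (z - zs))\<^sup>2)) \<longlongrightarrow> D + 0 * (\<gamma> / 2 * (norm (z - zs))\<^sup>2)) (at_right 0)"
    by (intro tendsto_intros)
  ultimately have "D + 0 * (\<gamma> / 2 * (norm (z - zs))\<^sup>2) \<ge> 0"
    by (intro tendsto_lowerbound[of _ _ "at_right (0::real)"]) auto
  then show ?thesis by (simp add: D_def)
qed

text \<open>\<open>step_vi\<close> is one implicit step in the metric \<open>G\<close>. Membership
  in the domain is assumed from index 1 on, because the starting point is unrestricted.\<close>

locale proximal_point =
  fixes \<Omega> :: "'a::euclidean_space set" and \<theta> :: "'a \<Rightarrow> real" and F G :: "'a \<Rightarrow> 'a"
    and w :: "nat \<Rightarrow> 'a"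
  assumes convex_dom: "convex \<Omega>" and closed_dom: "closed \<Omega>"
    and convex_fun: "convex_on UNIV \<theta>"
    and continuous_op: "continuous_on UNIV F"
    and monotone_op: "(u - v) \<bullet> (F u - F v) \<ge> 0"
    and linear_G: "linear G" and sym_G: "u \<bullet> G v = G u \<bullet> v"
    and pos_G: "u \<noteq> 0 \<Longrightarrow> u \<bullet> G u > 0"
    and step_mem: "w (Suc k) \<in> \<Omega>"
    and step_vi: "v \<in> \<Omega> \<Longrightarrow>
      \<theta> v - \<theta> (w (Suc k)) + (v - w (Suc k)) \<bullet> (F (w (Suc k)) + G (w (Suc k) - w k)) \<ge> 0"
begin

definition Q :: "'a \<Rightarrow> real" where "Q u = u \<bullet> G u"

definition solutions :: "'a set" where
  "solutions = {ws \<in> \<Omega>. \<forall>v\<in>\<Omega>. \<theta> v - \<theta> ws + (v - ws) \<bullet> F ws \<ge> 0}"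

section \<open>The form \<open>Q\<close> and the inequalities satisfied by successive
  iterates\<close>

lemma Q_nonneg: "Q u \<ge> 0"
  by (cases "u = 0") (use pos_G[of u] in \<open>auto simp: Q_def\<close>)

lemma Q_add: "Q (u + v) = Q u + Q v + 2 * (u \<bullet> G v)"
  using sym_G[of u v]
  by (simp add: Q_def linear_add[OF linear_G] inner_add_left inner_add_right inner_commute)

lemma Q_minus: "Q (- u) = Q u"
  by (simp add: Q_def linear_neg[OF linear_G])

lemma Q_diff_commute: "Q (u - v) = Q (v - u)"
  using Q_minus[of "u - v"] by simp

text \<open>Expand \<open>Q\<close> at \<open>c - b = (c - a) + (a - b)\<close>. This turns the
  proximal term of \<open>step_vi\<close> into a telescoping difference.\<close>

lemma three_point: "2 * ((c - a) \<bullet> G (a - b)) = Q (b - c) - Q (a - c) - Q (a - b)"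
  using Q_add[of "c - a" "a - b"] by (simp add: Q_diff_commute)

lemma isCont_G: "isCont G u"
  using linear_G linear_continuous_at linear_conv_bounded_linear by blast

lemma tendsto_Q: "(f \<longlongrightarrow> l) net \<Longrightarrow> ((\<lambda>n. Q (f n)) \<longlongrightarrow> Q l) net"
  unfolding Q_def by (intro tendsto_intros isCont_tendsto_compose[OF isCont_G])

text \<open>Maximizing the Rayleigh quotient of \<open>- G\<close> minimizes \<open>Q\<close> on the
  unit sphere; the minimum is positive and serves as \<open>c\<close>.\<close>

lemma Q_coercive:
  obtains c where "c > 0" "\<And>u. c * (norm u)\<^sup>2 \<le> Q u"
proof -
  have "linear (\<lambda>u. - G u)" using linear_G by (rule linear_compose_neg)
  then obtain v where v: "norm v = 1" "\<And>z. z \<bullet> - G z \<le> (v \<bullet> - G v) * (norm z)\<^sup>2"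
    by (rule exists_rayleigh_maximizer) (rule that)
  from v(1) have "v \<noteq> 0" by auto
  then have "Q v > 0" using pos_G by (simp add: Q_def)
  with v(2) show ?thesis by (intro that[of "Q v"]) (simp_all add: Q_def)
qed

lemma tendsto_if_Q_tendsto_0:
  assumes "(\<lambda>n. Q (f n)) \<longlonglongrightarrow> 0"
  shows "f \<longlonglongrightarrow> 0"
proof -
  obtain c where c: "c > 0" "\<And>u. c * (norm u)\<^sup>2 \<le> Q u" using Q_coercive by blast
  have "(\<lambda>n. (norm (f n))\<^sup>2) \<longlonglongrightarrow> 0"
  proof (rule tendsto_sandwich[of "\<lambda>_. 0"])
    show "\<forall>\<^sub>F n in sequentially. (norm (f n))\<^sup>2 \<le> Q (f n) / c"
      using c by (simp add: pos_le_divide_eq mult.commute)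
    show "(\<lambda>n. Q (f n) / c) \<longlonglongrightarrow> 0" using tendsto_divide[OF assms tendsto_const[of c]] c by simp
  qed auto
  then show ?thesis by (simp add: tendsto_norm_zero_iff)
qed

text \<open>\<open>three_point\<close> rewrites the \<open>G\<close> term, and monotonicity replaces
  \<open>F (w (Suc k))\<close> by \<open>F v\<close>. The right side then suits both uses: it is
  nonpositive when \<open>v\<close> is a solution, and its operator value does not depend on
  \<open>k\<close> when averaged.\<close>

lemma step_descent:
  assumes "v \<in> \<Omega>"
  shows "Q (w (Suc k) - v) - Q (w k - v) + Q (w (Suc k) - w k)
    \<le> 2 * (\<theta> v - \<theta> (w (Suc k)) + (v - w (Suc k)) \<bullet> F v)"
  using step_vi[OF assms, of k] monotone_op[of v "w (Suc k)"]
    three_point[of v "w (Suc k)" "w k"]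
  by (simp add: inner_add_right inner_diff_right)

text \<open>The new iterate lies in the domain, so it may be tested in the inequality that defines
  \<open>ws\<close>; this makes the right side of \<open>step_descent\<close> nonpositive.\<close>

lemma fejer:
  assumes "ws \<in> solutions"
  shows "Q (w (Suc k) - ws) + Q (w (Suc k) - w k) \<le> Q (w k - ws)"
proof -
  have "\<theta> (w (Suc k)) - \<theta> ws + (w (Suc k) - ws) \<bullet> F ws \<ge> 0" and "ws \<in> \<Omega>"
    using assms step_mem by (auto simp: solutions_def)
  then show ?thesis using step_descent[of ws k] by (simp add: inner_diff_left)
qed

text \<open>Telescoped \<open>fejer\<close>. The sum controls the steps, and the remaining distance
  to \<open>ws\<close> bounds the iterates.\<close>

lemma sum_Q_steps_le:
  assumes "ws \<in> solutions"
  shows "(\<Sum>i<k. Q (w (Suc i) - w i)) + Q (w k - ws) \<le> Q (w 0 - ws)"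
proof (induction k)
  case (Suc k)
  then show ?case using fejer[OF assms, of k] by simp
qed simp

lemma Q_steps_decseq: "decseq (\<lambda>k. Q (w (Suc k) - w k))"
proof (rule decseq_SucI)
  fix k
  let ?d = "w (Suc k) - w k" and ?e = "w (Suc (Suc k)) - w (Suc k)"
  \<comment> \<open>test each of two consecutive inequalities with the iterate of the other and add\<close>
  have "(- ?e) \<bullet> G (?e - ?d) \<ge> 0"
    using step_vi[OF step_mem[of k], of "Suc k"] step_vi[OF step_mem[of "Suc k"], of k]
      monotone_op[of "w (Suc (Suc k))" "w (Suc k)"]
    by (simp add: linear_diff[OF linear_G] inner_add_right inner_diff_right inner_diff_left)
  \<comment> \<open>Expanding \<open>Q ?d\<close> around \<open>?e\<close> leaves a square and a
    cross term; the cross term is the quantity just shown nonnegative.\<close>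
  moreover have "Q ?d = Q ?e + Q (?d - ?e) + 2 * (?e \<bullet> G (?d - ?e))"
    using Q_add[of ?e "?d - ?e"] by simp
  moreover have "(- u) \<bullet> G v = u \<bullet> G (- v)" for u v
    by (simp add: linear_neg[OF linear_G])
  from this[of ?e "?e - ?d"] have "(- ?e) \<bullet> G (?e - ?d) = ?e \<bullet> G (?d - ?e)"
    by (simp only: minus_diff_eq[of ?e ?d])
  ultimately show "Q ?e \<le> Q ?d" using Q_nonneg[of "?d - ?e"] by linarith
qed

section \<open>Step rates, convergence and the ergodic average\<close>

lemma summable_Q_steps:
  assumes "solutions \<noteq> {}"
  shows "summable (\<lambda>k. Q (w (Suc k) - w k))"
proof -
  obtain ws where ws: "ws \<in> solutions" using assms by blast
  have "(\<Sum>i<k. Q (w (Suc i) - w i)) \<le> Q (w 0 - ws)" for k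
    using sum_Q_steps_le[OF ws, of k] Q_nonneg[of "w k - ws"] by linarith
  then show ?thesis by (intro summableI_nonneg_bounded Q_nonneg)
qed

text \<open>The latest of the first \<open>k\<close> steps is the smallest, so \<open>k\<close>
  times it is at most their sum.\<close>

lemma Q_step_le:
  assumes "ws \<in> solutions" "k > 0"
  shows "Q (w k - w (k - 1)) \<le> Q (w 0 - ws) / real k"
proof -
  have "real k * Q (w k - w (k - 1)) \<le> (\<Sum>i<k. Q (w (Suc i) - w i))"
    using sum_bounded_below[of "{..<k}" "Q (w k - w (k - 1))" "\<lambda>i. Q (w (Suc i) - w i)"]
      decseqD[OF Q_steps_decseq, of _ "k - 1"] assms(2) by auto
  also have "\<dots> \<le> Q (w 0 - ws)"
    using sum_Q_steps_le[OF assms(1), of k] Q_nonneg[of "w k - ws"] by linarith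
  finally show ?thesis using assms(2) by (simp add: pos_le_divide_eq mult.commute)
qed

lemma Q_step_smallo:
  assumes "solutions \<noteq> {}"
  shows "(\<lambda>k. Q (w k - w (k - 1))) \<in> o(\<lambda>k. 1 / real k)"
proof (rule smalloI_tendsto)
  let ?a = "\<lambda>k. Q (w (Suc k) - w k)"
  note sm = summable_Q_steps[OF assms]
  have "(\<lambda>k. real k * ?a k) \<longlonglongrightarrow> 0"
    by (rule decseq_summable_imp_mult_tendsto_0[OF Q_steps_decseq sm Q_nonneg])
  \<comment> \<open>Index shift: \<open>?a k\<close> is step number \<open>k + 1\<close>, so the
    factor must be \<open>k + 1\<close>, and the extra summand \<open>?a k\<close> tends to 0 as
    well.\<close>
  from tendsto_add[OF this summable_LIMSEQ_zero[OF sm]]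
  have "(\<lambda>k. Q (w (Suc k) - w (Suc k - 1)) / (1 / real (Suc k))) \<longlonglongrightarrow> 0"
    by (simp add: algebra_simps)
  then show "(\<lambda>k. Q (w k - w (k - 1)) / (1 / real k)) \<longlonglongrightarrow> 0"
    by (rule LIMSEQ_imp_Suc)
  show "\<forall>\<^sub>F k in sequentially. 1 / real k \<noteq> 0"
    using eventually_gt_at_top[of 0] by eventually_elim simp
qed

text \<open>The steps tend to 0, so the \<open>G\<close> term disappears when \<open>step_vi\<close>
  passes to the limit along the subsequence; \<open>\<theta>\<close> is continuous because it is
  finite and convex on the whole space. The shift by \<open>Suc\<close> keeps the subsequence inside
  the domain.\<close>

lemma cluster_point_solution:
  assumes "solutions \<noteq> {}" and r: "strict_mono r" and lim: "(\<lambda>n. w (Suc (r n))) \<longlonglongrightarrow> l"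
  shows "l \<in> solutions"
  unfolding solutions_def
proof (intro CollectI conjI ballI)
  show "l \<in> \<Omega>"
    by (rule closed_sequentially[OF closed_dom step_mem lim])
  fix v assume v: "v \<in> \<Omega>"
  have "(\<lambda>k. w (Suc k) - w k) \<longlonglongrightarrow> 0"
    by (rule tendsto_if_Q_tendsto_0[OF summable_LIMSEQ_zero[OF summable_Q_steps[OF assms(1)]]])
  then have d: "(\<lambda>n. w (Suc (r n)) - w (r n)) \<longlonglongrightarrow> 0"
    using LIMSEQ_subseq_LIMSEQ[OF _ r] by (simp add: o_def)
  have "isCont \<theta> l"
    using convex_on_continuous[OF open_UNIV convex_fun] by (simp add: continuous_on_eq_continuous_at)
  then have th: "(\<lambda>n. \<theta> (w (Suc (r n)))) \<longlonglongrightarrow> \<theta> l" using lim by (rule isCont_tendsto_compose)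
  have "isCont F l" using continuous_op by (simp add: continuous_on_eq_continuous_at)
  then have F: "(\<lambda>n. F (w (Suc (r n)))) \<longlonglongrightarrow> F l" using lim by (rule isCont_tendsto_compose)
  have "(\<lambda>n. \<theta> v - \<theta> (w (Suc (r n))) + (v - w (Suc (r n))) \<bullet> (F (w (Suc (r n))) + G (w (Suc (r n)) - w (r n))))
      \<longlonglongrightarrow> \<theta> v - \<theta> l + (v - l) \<bullet> (F l + G 0)"
    by (intro tendsto_intros th F lim isCont_tendsto_compose[OF isCont_G d])
  then have "0 \<le> \<theta> v - \<theta> l + (v - l) \<bullet> (F l + G 0)"
    by (rule LIMSEQ_le_const) (use step_vi[OF v] in blast)
  then show "0 \<le> \<theta> v - \<theta> l + (v - l) \<bullet> F l" by (simp add: linear_0[OF linear_G])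
qed

text \<open>Boundedness yields a cluster point \<open>l\<close>, which is a solution. So
  \<open>fejer\<close> applies with \<open>l\<close> itself: the \<open>Q\<close> distance to
  \<open>l\<close> is monotone and tends to 0 along a subsequence, hence along the whole
  sequence.\<close>

lemma iterates_convergent:
  assumes "solutions \<noteq> {}"
  obtains l where "l \<in> solutions" "w \<longlonglongrightarrow> l"
proof -
  obtain ws where ws: "ws \<in> solutions" using assms by blast
  obtain c where c: "c > 0" "\<And>u. c * (norm u)\<^sup>2 \<le> Q u" using Q_coercive by blast
  have "norm (w (Suc k) - ws) \<le> sqrt (Q (w 0 - ws) / c)" for k
  proof (rule real_le_rsqrt)
    have "c * (norm (w (Suc k) - ws))\<^sup>2 \<le> Q (w (Suc k) - ws)" by (rule c)
    also have "\<dots> \<le> Q (w 0 - ws)"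
      using sum_Q_steps_le[OF ws, of "Suc k"] sum_nonneg[of "{..<Suc k}" "\<lambda>i. Q (w (Suc i) - w i)"] Q_nonneg
      by fastforce
    finally show "(norm (w (Suc k) - ws))\<^sup>2 \<le> Q (w 0 - ws) / c"
      using c by (simp add: pos_le_divide_eq mult.commute)
  qed
  then have "bounded (range (\<lambda>k. w (Suc k)))"
    unfolding bounded_any_center[of _ ws]
    by (auto simp: dist_norm norm_minus_commute)
  then obtain l r where r: "strict_mono r" and lim: "(\<lambda>n. w (Suc (r n))) \<longlonglongrightarrow> l"
    using bounded_imp_convergent_subsequence[of "\<lambda>k. w (Suc k)"] by (auto simp: o_def)
  have l: "l \<in> solutions" by (rule cluster_point_solution[OF assms r lim])
  have dec: "decseq (\<lambda>k. Q (w (Suc k) - l))"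
  proof (rule decseq_SucI)
    fix k show "Q (w (Suc (Suc k)) - l) \<le> Q (w (Suc k) - l)"
      using fejer[OF l, of "Suc k"] Q_nonneg[of "w (Suc (Suc k)) - w (Suc k)"] by linarith
  qed
  then obtain L where L: "(\<lambda>k. Q (w (Suc k) - l)) \<longlonglongrightarrow> L"
    by (rule decseq_convergent[where B = 0]) (auto intro: Q_nonneg)
  have "(\<lambda>n. Q (w (Suc (r n)) - l)) \<longlonglongrightarrow> L"
    using LIMSEQ_subseq_LIMSEQ[OF L r] by (simp add: o_def)
  moreover have "(\<lambda>n. Q (w (Suc (r n)) - l)) \<longlonglongrightarrow> Q (l - l)"
    by (intro tendsto_Q tendsto_intros lim)
  ultimately have "L = 0" using LIMSEQ_unique by (fastforce simp: Q_def)
  with L have "(\<lambda>k. w (Suc k) - l) \<longlonglongrightarrow> 0" by (intro tendsto_if_Q_tendsto_0) simp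
  then have "w \<longlonglongrightarrow> l" by (intro LIMSEQ_imp_Suc[of w]) (simp add: LIM_zero_iff)
  with l that show ?thesis by blast
qed

text \<open>Summing \<open>step_descent\<close> at a fixed \<open>v\<close> telescopes the
  distances. The pairing with \<open>F v\<close> is affine in the iterate and averages exactly;
  \<open>\<theta>\<close> averages by Jensen.\<close>

lemma ergodic:
  defines "wbar \<equiv> \<lambda>k. (1 / (real k + 1)) *\<^sub>R (\<Sum>i = 0..k. w (i + 1))"
  shows "wbar k \<in> \<Omega>"
    and "v \<in> \<Omega> \<Longrightarrow>
      \<theta> v - \<theta> (wbar k) + (v - wbar k) \<bullet> F v \<ge> - (Q (v - w 0) / (2 * (real k + 1)))"
proof -
  define a where "a = 1 / (real k + 1)"
  have wb: "wbar k = (\<Sum>i\<in>{0..k}. a *\<^sub>R w (i + 1))"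
    by (simp add: wbar_def a_def scaleR_sum_right)
  have a: "(\<Sum>i\<in>{0..k}. a) = 1" "a > 0" by (auto simp: a_def field_simps)
  show "wbar k \<in> \<Omega>" unfolding wb
    by (rule convex_sum) (use a convex_dom step_mem in auto)
  assume v: "v \<in> \<Omega>"
  have jensen: "\<theta> (wbar k) \<le> (\<Sum>i\<in>{0..k}. a * \<theta> (w (i + 1)))" unfolding wb
    by (rule convex_on_sum) (use a convex_fun in auto)
  have "(\<Sum>i=0..k. Q (w (Suc i) - v) - Q (w i - v)) = Q (w (Suc k) - v) - Q (w 0 - v)"
    by (rule sum_Suc_diff) simp
  then have "- Q (w 0 - v) \<le> (\<Sum>i=0..k. Q (w (Suc i) - v) - Q (w i - v))"
    using Q_nonneg[of "w (Suc k) - v"] by linarith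
  also have "\<dots> \<le> (\<Sum>i=0..k. 2 * (\<theta> v - \<theta> (w (Suc i)) + (v - w (Suc i)) \<bullet> F v))"
  proof (rule sum_mono)
    fix i
    show "Q (w (Suc i) - v) - Q (w i - v) \<le> 2 * (\<theta> v - \<theta> (w (Suc i)) + (v - w (Suc i)) \<bullet> F v)"
      using step_descent[OF v, of i] Q_nonneg[of "w (Suc i) - w i"] by linarith
  qed
  \<comment> \<open>Multiplying by \<open>a / 2\<close> cancels the factor 2 of the descent
    inequality and turns the sum into a convex combination with weights \<open>a\<close>.\<close>
  finally have "a / 2 * - Q (w 0 - v)
      \<le> a / 2 * (\<Sum>i=0..k. 2 * (\<theta> v - \<theta> (w (Suc i)) + (v - w (Suc i)) \<bullet> F v))"
    using a by (intro mult_left_mono) auto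
  also have "\<dots> = (\<Sum>i=0..k. a * \<theta> v - a * \<theta> (w (i + 1)) + ((a *\<^sub>R v) \<bullet> F v - (a *\<^sub>R w (i + 1)) \<bullet> F v))"
    unfolding sum_distrib_left by (intro sum.cong) (simp_all add: inner_diff_left right_diff_distrib distrib_left)
  also have "\<dots> = (\<Sum>i=0..k. a) * \<theta> v - (\<Sum>i=0..k. a * \<theta> (w (i + 1)))
      + (((\<Sum>i=0..k. a) *\<^sub>R v) \<bullet> F v - wbar k \<bullet> F v)"
    by (simp only: wb sum.distrib sum_subtractf sum_distrib_right inner_sum_left scaleR_sum_left)
  also have "\<dots> \<le> \<theta> v - \<theta> (wbar k) + (v - wbar k) \<bullet> F v"
    using jensen unfolding a(1) by (simp add: inner_diff_left)
  finally show "\<theta> v - \<theta> (wbar k) + (v - wbar k) \<bullet> F v \<ge> - (Q (v - w 0) / (2 * (real k + 1)))"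
    unfolding a_def Q_diff_commute[of v] by (simp add: mult.commute)
qed

end

subsection \<open>Linearized ADMM as a proximal point method\<close>

lemma linear_G_mat: "linear (G_mat A B \<beta> \<tau> \<eta>)"
  by (rule linearI)
     (auto simp: G_mat_def matrix_vector_right_distrib matrix_vector_mult_scaleR algebra_simps
       simp del: transpose_matrix_vector)

lemma G_mat_symmetric: "u \<bullet> G_mat A B \<beta> \<tau> \<eta> v = G_mat A B \<beta> \<tau> \<eta> u \<bullet> v"
proof -
  obtain x y p x' y' p' where "u = (x, y, p)" "v = (x', y', p')" by (metis prod_cases3)
  then show ?thesis
    by (simp add: G_mat_def matrix_vector_mult_diff_rdistrib scaleR_matrix_vector_assoc[symmetric]
        matrix_vector_mul_assoc[symmetric] inner_diff_left inner_diff_right inner_add_left inner_add_right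
        inner_vector_matrix inner_commute[of "_ v* _"])
       (simp add: inner_commute algebra_simps)
qed

text \<open>Completing the square in \<open>p\<close> decouples the \<open>y\<close> and
  \<open>p\<close> blocks, so each step size condition governs one summand.\<close>

lemma G_mat_quadratic_form:
  assumes "\<beta> > 0"
  shows "(x, y, p) \<bullet> G_mat A B \<beta> \<tau> \<eta> (x, y, p) =
    \<beta> * ((norm x)\<^sup>2 / \<tau> - (norm (A *v x))\<^sup>2) + \<beta> * ((norm y)\<^sup>2 / \<eta> - (norm (B *v y))\<^sup>2)
      + (norm (p - \<beta> *\<^sub>R (B *v y)))\<^sup>2 / \<beta>"
  using assms
  by (simp add: G_mat_def matrix_vector_mult_diff_rdistrib scaleR_matrix_vector_assoc[symmetric]
      matrix_vector_mul_assoc[symmetric] inner_diff_left inner_diff_right inner_add_left inner_add_right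
      inner_vector_matrix power2_norm_eq_inner)
     (simp add: field_simps inner_commute)

text \<open>All three summands are nonnegative. A nonzero \<open>x\<close> or \<open>y\<close> makes
  its own summand positive; if both vanish, the last one is a positive multiple of the squared norm
  of \<open>p\<close>.\<close>

lemma G_mat_positive:
  assumes "\<beta> > 0"
    and "0 < \<tau>" "ereal \<tau> < 1 / ereal (spectral_radius (transpose A ** A))"
    and "0 < \<eta>" "ereal \<eta> < 1 / ereal (spectral_radius (transpose B ** B))"
    and "u \<noteq> 0"
  shows "u \<bullet> G_mat A B \<beta> \<tau> \<eta> u > 0"
proof -
  obtain x y p where u: "u = (x, y, p)" by (metis prod_cases3)
  define a where "a = \<beta> * ((norm x)\<^sup>2 / \<tau> - (norm (A *v x))\<^sup>2)"
  define c where "c = \<beta> * ((norm y)\<^sup>2 / \<eta> - (norm (B *v y))\<^sup>2)"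
  define d where "d = (norm (p - \<beta> *\<^sub>R (B *v y)))\<^sup>2 / \<beta>"
  have a: "x \<noteq> 0 \<Longrightarrow> a > 0" "x = 0 \<Longrightarrow> a = 0"
    using norm_matrix_vector_less_step_size[of \<tau> A x] assms by (auto simp: a_def)
  have c: "y \<noteq> 0 \<Longrightarrow> c > 0" "y = 0 \<Longrightarrow> c = 0"
    using norm_matrix_vector_less_step_size[of \<eta> B y] assms by (auto simp: c_def)
  have d: "d \<ge> 0" "y = 0 \<Longrightarrow> p \<noteq> 0 \<Longrightarrow> d > 0"
    using assms by (auto simp: d_def)
  have "a + c + d > 0"
    using \<open>u \<noteq> 0\<close> a c d unfolding u zero_prod_def prod.inject by (smt (verit))
  then show ?thesis
    unfolding u G_mat_quadratic_form[OF assms(1)] a_def c_def d_def .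
qed

text \<open>The constant \<open>b\<close> cancels in the difference, and the linear part has
  opposite transposes as off-diagonal blocks. Monotonicity thus holds with equality.\<close>

lemma vi_map_skew: "(u - v) \<bullet> (vi_map A B b u - vi_map A B b v) = 0"
proof -
  obtain x y p x' y' p' where "u = (x, y, p)" "v = (x', y', p')" by (metis prod_cases3)
  then show ?thesis
    by (simp add: vi_map_def inner_diff_left inner_diff_right inner_add_left inner_add_right
        inner_vector_matrix inner_commute[of "_ v* _"])
       (simp add: inner_commute algebra_simps)
qed

lemma continuous_vi_map: "continuous_on UNIV (vi_map A B b)"
proof -
  have lin: "bounded_linear (\<lambda>z. M *v h z)" if "bounded_linear h"
    for M :: "real^'i^'j" and h :: "'e::real_normed_vector \<Rightarrow> real^'i"
    using bounded_linear_compose[OF matrix_vector_mul_bounded_linear that, of M] .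
  have eq: "vi_map A B b = (\<lambda>w. (- (transpose A *v snd (snd w)), - (transpose B *v snd (snd w)),
      A *v fst w + B *v fst (snd w) - b))"
    by (auto simp: vi_map_def)
  show ?thesis unfolding eq
    by (intro continuous_intros linear_continuous_on lin bounded_linear_fst bounded_linear_snd
        bounded_linear_fst_comp bounded_linear_snd_comp bounded_linear_ident)
qed

lemma convex_theta:
  fixes f :: "real^'n1 \<Rightarrow> real" and g :: "real^'n2 \<Rightarrow> real"
  assumes "convex_on UNIV f" "convex_on UNIV g"
  shows "convex_on UNIV (theta f g :: (real^'n1) \<times> (real^'n2) \<times> (real^'m) \<Rightarrow> real)"
proof (rule convex_onI)
  fix t :: real and u v :: "(real^'n1) \<times> (real^'n2) \<times> (real^'m)"
  assume t: "0 < t" "t < 1"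
  obtain x y x' y' and p p' :: "real^'m" where uv: "u = (x, y, p)" "v = (x', y', p')" by (metis prod_cases3)
  have "f ((1 - t) *\<^sub>R x + t *\<^sub>R x') \<le> (1 - t) * f x + t * f x'"
    "g ((1 - t) *\<^sub>R y + t *\<^sub>R y') \<le> (1 - t) * g y + t * g y'"
    using t by (auto intro!: convex_onD[OF assms(1)] convex_onD[OF assms(2)])
  then show "theta f g ((1 - t) *\<^sub>R u + t *\<^sub>R v) \<le> (1 - t) * theta f g u + t * theta f g v"
    by (simp add: uv theta_def algebra_simps)
qed simp

text \<open>The two subproblems supply the \<open>x\<close> and \<open>y\<close> rows through
  \<open>proximal_optimality\<close>, with \<open>\<gamma>\<close> equal to
  \<open>\<beta> / \<tau>\<close> and \<open>\<beta> / \<eta>\<close>; the multiplier update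
  supplies the \<open>p\<close> row as an equation.\<close>

lemma linearized_admm_step_vi:
  assumes f: "convex_on UNIV f" and g: "convex_on UNIV g" and X: "convex X" and Y: "convex Y"
    and "\<beta> > 0" "\<tau> > 0" "\<eta> > 0"
    and admm: "linearized_admm f g X Y A B b \<beta> \<tau> \<eta> x y p"
    and w: "\<And>k. w k = (x k, y k, p k)"
    and v: "v \<in> Omega X Y"
  shows "theta f g v - theta f g (w (Suc k))
    + (v - w (Suc k)) \<bullet> (vi_map A B b (w (Suc k)) + G_mat A B \<beta> \<tau> \<eta> (w (Suc k) - w k)) \<ge> 0"
proof -
  obtain x' y' p' where v': "v = (x', y', p')" "x' \<in> X" "y' \<in> Y"
    using v by (auto simp: Omega_def)
  define u where "u = transpose A *v (A *v x k + B *v y k - b)"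
  define z where "z = transpose B *v (A *v x (Suc k) + B *v y k - b)"
  have "is_arg_min
          (\<lambda>z. f z - p k \<bullet> (A *v z) + (\<beta> / \<tau>) / 2 * (norm (z - (x k - \<tau> *\<^sub>R u)))\<^sup>2)
          (\<lambda>z. z \<in> X) (x (Suc k))"
    and pk: "p (Suc k) = p k - \<beta> *\<^sub>R (A *v x (Suc k) + B *v y k - b)"
    and "is_arg_min
          (\<lambda>u. g u - p (Suc k) \<bullet> (B *v u) + (\<beta> / \<eta>) / 2 * (norm (u - (y k - \<eta> *\<^sub>R z)))\<^sup>2)
          (\<lambda>u. u \<in> Y) (y (Suc k))"
    using admm[unfolded linearized_admm_def Let_def, rule_format, of k]
    unfolding u_def z_def divide_divide_eq_left mult.commute[of 2] by blast+
  then have fx: "f x' - f (x (Suc k)) - p k \<bullet> (A *v (x' - x (Suc k)))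
        + \<beta> / \<tau> * ((x' - x (Suc k)) \<bullet> (x (Suc k) - (x k - \<tau> *\<^sub>R u))) \<ge> 0"
    and gy: "g y' - g (y (Suc k)) - p (Suc k) \<bullet> (B *v (y' - y (Suc k)))
        + \<beta> / \<eta> * ((y' - y (Suc k)) \<bullet> (y (Suc k) - (y k - \<eta> *\<^sub>R z))) \<ge> 0"
    using proximal_optimality[OF f X matrix_vector_mul_linear _ v'(2)]
      proximal_optimality[OF g Y matrix_vector_mul_linear _ v'(3)] by blast+
  define dx where "dx = x' - x (Suc k)"
  define dy where "dy = y' - y (Suc k)"
  define ex where "ex = x (Suc k) - x k"
  define ey where "ey = y (Suc k) - y k"
  define ep where "ep = p (Suc k) - p k"
  \<comment> \<open>The mixed residual, with new \<open>x\<close> and old \<open>y\<close>, drives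
    both the multiplier and the \<open>y\<close> update; the residual used in the \<open>x\<close>
    step is \<open>r - A *v ex\<close>.\<close>
  define r where "r = A *v x (Suc k) + B *v y k - b"
  have ep: "ep = - (\<beta> *\<^sub>R r)" using pk by (simp add: ep_def r_def)
  have p_k: "p k = p (Suc k) + \<beta> *\<^sub>R r" using ep by (simp add: ep_def algebra_simps)
  have u: "dx \<bullet> u = (A *v dx) \<bullet> (r - A *v ex)"
    unfolding u_def transpose_matrix_vector inner_vector_matrix
    by (simp add: r_def ex_def matrix_vector_mult_diff_distrib algebra_simps)
  have z: "dy \<bullet> z = (B *v dy) \<bullet> r"
    unfolding z_def transpose_matrix_vector inner_vector_matrix by (simp add: r_def)
  have 1: "\<beta> / \<tau> * (dx \<bullet> (x (Suc k) - (x k - \<tau> *\<^sub>R u)))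
      = \<beta> / \<tau> * (dx \<bullet> ex) + \<beta> * ((A *v dx) \<bullet> (r - A *v ex))"
    unfolding u[symmetric] using \<open>\<tau> > 0\<close>
    by (simp add: ex_def inner_diff_right inner_add_right field_simps)
  have 2: "\<beta> / \<eta> * (dy \<bullet> (y (Suc k) - (y k - \<eta> *\<^sub>R z)))
      = \<beta> / \<eta> * (dy \<bullet> ey) + \<beta> * ((B *v dy) \<bullet> r)"
    unfolding z[symmetric] using \<open>\<eta> > 0\<close>
    by (simp add: ey_def inner_diff_right inner_add_right field_simps)
  have d: "v - w (Suc k) = (dx, dy, p' - p (Suc k))" "w (Suc k) - w k = (ex, ey, ep)"
    by (simp_all add: v' w dx_def dy_def ex_def ey_def ep_def)
  \<comment> \<open>The \<open>p\<close> block of operator plus metric term vanishes, so the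
    \<open>p\<close> component of the test point is arbitrary.\<close>
  have 3: "A *v x (Suc k) + B *v y (Suc k) - b + (- (B *v ey) + (1 / \<beta>) *\<^sub>R ep) = 0"
    using \<open>\<beta> > 0\<close> by (simp add: ep ey_def r_def matrix_vector_mult_diff_distrib)
  have "(v - w (Suc k)) \<bullet> (vi_map A B b (w (Suc k)) + G_mat A B \<beta> \<tau> \<eta> (w (Suc k) - w k))
      = - ((A *v dx) \<bullet> p (Suc k)) + \<beta> / \<tau> * (dx \<bullet> ex) - \<beta> * ((A *v dx) \<bullet> (A *v ex))
        - (B *v dy) \<bullet> p (Suc k) + \<beta> / \<eta> * (dy \<bullet> ey) + \<beta> * ((B *v dy) \<bullet> r)"
    unfolding d by (simp only: w vi_map_def G_mat_def prod.case add_Pair inner_Pair 3 inner_zero_right)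
      (simp add: ep inner_add_right inner_vector_matrix matrix_vector_mult_diff_rdistrib
        scaleR_matrix_vector_assoc[symmetric] matrix_vector_mul_assoc[symmetric]
        inner_diff_right right_diff_distrib)
  moreover have "theta f g v - theta f g (w (Suc k)) = f x' - f (x (Suc k)) + (g y' - g (y (Suc k)))"
    by (simp add: theta_def v' w)
  \<comment> \<open>Replacing the old multiplier by the new one produces a term in \<open>r\<close>
    that cancels the one from the linearized penalty. What remains is the \<open>x\<close> block of
    \<open>G\<close>.\<close>
  moreover have "f x' - f (x (Suc k)) - (A *v dx) \<bullet> p (Suc k)
      + \<beta> / \<tau> * (dx \<bullet> ex) - \<beta> * ((A *v dx) \<bullet> (A *v ex)) \<ge> 0"
    using fx unfolding dx_def[symmetric] 1 p_k
    by (simp add: inner_add_right inner_diff_right right_diff_distrib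
        inner_commute[of _ "A *v dx"])
  moreover have "g y' - g (y (Suc k)) - (B *v dy) \<bullet> p (Suc k)
      + \<beta> / \<eta> * (dy \<bullet> ey) + \<beta> * ((B *v dy) \<bullet> r) \<ge> 0"
    using gy unfolding dy_def[symmetric] 2 by (simp add: inner_commute)
  ultimately show ?thesis by linarith
qed

section \<open>Consequences for the constrained problem and the Lagrangian\<close>

lemma Omega_star_imp_solution:
  assumes "(xs, ys, ps) \<in> Omega_star f g X Y A B b"
  shows "is_solution f g X Y A B b (xs, ys)"
proof -
  define r where "r = A *v xs + B *v ys - b"
  have mem: "xs \<in> X" "ys \<in> Y" using assms by (auto simp: Omega_star_def Omega_def)
  have vi: "f x + g y - (f xs + g ys) - (A *v (x - xs)) \<bullet> ps - (B *v (y - ys)) \<bullet> ps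
      + (p - ps) \<bullet> r \<ge> 0" if "x \<in> X" "y \<in> Y" for x y p
  proof -
    have "(x, y, p) \<in> Omega X Y" using that by (simp add: Omega_def)
    then have "theta f g (x, y, p) - theta f g (xs, ys, ps)
        + ((x, y, p) - (xs, ys, ps)) \<bullet> vi_map A B b (xs, ys, ps) \<ge> 0"
      using assms unfolding Omega_star_def by blast
    then show ?thesis by (simp add: theta_def vi_map_def r_def inner_vector_matrix algebra_simps)
  qed
  \<comment> \<open>Moving only the multiplier, against the residual, forces feasibility.\<close>
  have "- (r \<bullet> r) \<ge> 0" using vi[OF mem, of "ps - r"] by simp
  then have r: "r = 0" by (metis inner_ge_zero inner_eq_zero_iff neg_0_le_iff_le order_antisym)
  then have feas: "A *v xs + B *v ys = b" by (simp add: r_def)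
  show ?thesis
    unfolding is_solution_def is_arg_min_linorder
  proof (intro conjI allI impI)
    fix q assume "case q of (x, y) \<Rightarrow> x \<in> X \<and> y \<in> Y \<and> A *v x + B *v y = b"
    then obtain x y where q: "q = (x, y)" "x \<in> X" "y \<in> Y" and eq: "A *v x + B *v y = b"
      by (cases q) auto
    \<comment> \<open>Both points are feasible, so the multiplier terms cancel and only the
      objectives are compared.\<close>
    have "(A *v (x - xs)) \<bullet> ps + (B *v (y - ys)) \<bullet> ps
        = ((A *v x + B *v y) - (A *v xs + B *v ys)) \<bullet> ps"
      by (simp add: matrix_vector_mult_diff_distrib inner_diff_left inner_add_left)
    also have "\<dots> = 0" by (simp add: eq feas)
    finally show "(case (xs, ys) of (x, y) \<Rightarrow> f x + g y) \<le> (case q of (x, y) \<Rightarrow> f x + g y)"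
      using vi[OF q(2,3), of ps] by (simp add: q)
  qed (use mem feas in simp)
qed

text \<open>The products of \<open>p\<close> with \<open>A *v x\<close> and \<open>B *v y\<close>
  cancel by skewness. Being an identity, it makes the two forms of the ergodic estimate
  equivalent.\<close>

lemma lagrangian_gap:
  "lagrangian f g A B b xb yb p - lagrangian f g A B b x y pb
    = - (theta f g (x, y, p) - theta f g (xb, yb, pb) + ((x, y, p) - (xb, yb, pb)) \<bullet> vi_map A B b (x, y, p))"
  by (simp add: lagrangian_def theta_def vi_map_def inner_diff_left inner_diff_right
      inner_add_right inner_vector_matrix matrix_vector_mult_diff_distrib inner_commute[of p])

theorem theorem4:
  fixes f :: "real^'n1 \<Rightarrow> real" and g :: "real^'n2 \<Rightarrow> real"
    and X :: "(real^'n1) set" and Y :: "(real^'n2) set"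
    and A :: "real^'n1^'m" and B :: "real^'n2^'m" and b :: "real^'m"
    and \<beta> \<tau> \<eta> :: real
    and x :: "nat \<Rightarrow> real^'n1" and y :: "nat \<Rightarrow> real^'n2" and p :: "nat \<Rightarrow> real^'m"
    and w wbar :: "nat \<Rightarrow> (real^'n1) \<times> (real^'n2) \<times> (real^'m)"
    and normG :: "(real^'n1) \<times> (real^'n2) \<times> (real^'m) \<Rightarrow> real"
  assumes "convex_on UNIV f" and "closed (epigraph UNIV f)"
    and "convex_on UNIV g" and "closed (epigraph UNIV g)"
    and "convex X" and "closed X" and "convex Y" and "closed Y"
    and "Omega_star f g X Y A B b \<noteq> {}"
    and "\<beta> > 0"
    \<comment> \<open>in the extended reals, the bound is \<open>1 / 0 = \<infinity>\<close> when the matrix is zero\<close>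
    and "0 < \<tau>" and "ereal \<tau> < 1 / ereal (spectral_radius (transpose A ** A))"
    and "0 < \<eta>" and "ereal \<eta> < 1 / ereal (spectral_radius (transpose B ** B))"
    and "linearized_admm f g X Y A B b \<beta> \<tau> \<eta> x y p"
    and w: "\<And>k. w k = (x k, y k, p k)"
    and wbar: "\<And>k. wbar k = (1 / (real k + 1)) *\<^sub>R (\<Sum>i = 0..k. w (i + 1))"
    and normG: "\<And>u. normG u = seminorm_of (G_mat A B \<beta> \<tau> \<eta>) u"
  shows
    "(\<exists>xs ys ps. (xs, ys, ps) \<in> Omega_star f g X Y A B b \<and> w \<longlonglongrightarrow> (xs, ys, ps)
        \<and> is_solution f g X Y A B b (xs, ys))
     \<and> (\<forall>k > 0.
          wbar k \<in> Omega X Y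
          \<and> (\<forall>v \<in> Omega X Y.
               theta f g v - theta f g (wbar k) + (v - wbar k) \<bullet> vi_map A B b v
                 \<ge> - ((normG (v - w 0))\<^sup>2 / (2 * (real k + 1))))
          \<and> (\<forall>xb yb pb. wbar k = (xb, yb, pb) \<longrightarrow>
               (\<forall>x' y' p'. (x', y', p') \<in> Omega X Y \<longrightarrow>
                  lagrangian f g A B b xb yb p' - lagrangian f g A B b x' y' pb
                    \<le> (normG ((x', y', p') - w 0))\<^sup>2 / (2 * (real k + 1)))))
     \<and> (\<forall>k > 0. \<forall>ws \<in> Omega_star f g X Y A B b.
          (normG (w k - w (k - 1)))\<^sup>2 \<le> (normG (w 0 - ws))\<^sup>2 / real k)
     \<and> (\<lambda>k. (normG (w k - w (k - 1)))\<^sup>2) \<in> o(\<lambda>k. 1 / real k)"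
proof -
  have dom: "convex (Omega X Y)" "closed (Omega X Y)"
    using assms by (auto simp: Omega_def intro!: convex_Times closed_Times)
  interpret proximal_point "Omega X Y" "theta f g" "vi_map A B b" "G_mat A B \<beta> \<tau> \<eta>" w
  proof (rule proximal_point.intro)
    show "u \<bullet> G_mat A B \<beta> \<tau> \<eta> u > 0" if "u \<noteq> 0" for u
      using G_mat_positive assms that by blast
    show "w (Suc k) \<in> Omega X Y" for k
      using assms(15)[unfolded linearized_admm_def Let_def, rule_format, of k]
      by (simp add: w Omega_def is_arg_min_def)
    show "0 \<le> theta f g v - theta f g (w (Suc k))
        + (v - w (Suc k)) \<bullet> (vi_map A B b (w (Suc k)) + G_mat A B \<beta> \<tau> \<eta> (w (Suc k) - w k))"
      if "v \<in> Omega X Y" for v k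
      by (rule linearized_admm_step_vi[OF assms(1,3,5,7,10,11,13,15) w that])
  qed (simp_all add: dom convex_theta assms continuous_vi_map vi_map_skew linear_G_mat
      G_mat_symmetric)
  have sol: "solutions = Omega_star f g X Y A B b"
    by (simp add: solutions_def Omega_star_def)
  \<comment> \<open>Squaring undoes the square root because \<open>Q\<close> is nonnegative.\<close>
  have Q: "(normG u)\<^sup>2 = Q u" for u
    using Q_nonneg[of u] by (simp add: normG seminorm_of_def Q_def)
  have ne: "solutions \<noteq> {}" using assms by (simp add: sol)
  have avg: "wbar k \<in> Omega X Y"
    "v \<in> Omega X Y \<Longrightarrow> theta f g v - theta f g (wbar k) + (v - wbar k) \<bullet> vi_map A B b v
      \<ge> - ((normG (v - w 0))\<^sup>2 / (2 * (real k + 1)))" for k v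
    unfolding wbar Q by (fact ergodic)+
  obtain l where l: "l \<in> solutions" "w \<longlonglongrightarrow> l" using iterates_convergent[OF ne] .
  obtain xs ys ps where "l = (xs, ys, ps)" by (metis prod_cases3)
  then have "\<exists>xs ys ps. (xs, ys, ps) \<in> Omega_star f g X Y A B b \<and> w \<longlonglongrightarrow> (xs, ys, ps)
        \<and> is_solution f g X Y A B b (xs, ys)"
    using l Omega_star_imp_solution unfolding sol by blast
  moreover have "lagrangian f g A B b xb yb p' - lagrangian f g A B b x' y' pb
      \<le> (normG ((x', y', p') - w 0))\<^sup>2 / (2 * (real k + 1))"
    if "wbar k = (xb, yb, pb)" "(x', y', p') \<in> Omega X Y" for k xb yb pb x' y' p'
    using avg(2)[OF that(2), of k] unfolding that(1) lagrangian_gap by linarith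
  moreover have "(normG (w k - w (k - 1)))\<^sup>2 \<le> (normG (w 0 - ws))\<^sup>2 / real k"
    if "k > 0" "ws \<in> Omega_star f g X Y A B b" for k ws
    using Q_step_le[of ws k] that unfolding sol Q by blast
  moreover have "(\<lambda>k. (normG (w k - w (k - 1)))\<^sup>2) \<in> o(\<lambda>k. 1 / real k)"
    unfolding Q by (rule Q_step_smallo[OF ne])
  ultimately show ?thesis using avg by blast
qed

end
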